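(* Let $G$ be a finite cyclic group with $|G| = n \ge 2$, and let $p$ be a prime divisor of $|G|$. Then $\nu (G) = \nu _p (G) = \mathsf d (G)-1$.
   Context: For a finite abelian group $G$ (written additively) let $G^{\bullet} = G\setminus\{0\}$. A sequence over $G$ is a finite unordered sequence of elements of $G$ with repetition allowed (an element of the free abelian monoid with basis $G$, written multiplicatively; the empty sequence is allowed); $|T|$ is the length of $T$, and $\Sigma(T)$ is the set of all sums of nonempty subsequences of $T$. $T$ is zero-sum free if $0\notin\Sigma(T)$. $\mathsf d(G)$ is the maximal length of a zero-sum free sequence over $G$. For nontrivial $G$, $\nu(G)$ is the smallest integer $\ell\ge 0$ such that for every zero-sum free sequence $T$ over $G$ with $|T|\ge \ell$ there are a subgroup $H\subsetneq G$ and some $\alpha\in G\setminus H$ with $G^{\bullet}\setminus\Sigma(T)\subseteq\alpha+H$. For a prime divisor $p$ of $|G|$, $\nu_p(G)$ is the smallest integer $\ell\ge 0$ such that for every zero-sum free sequence $T$ over $G$ with $|T|\ge\ell$ there are a subgroup $H\subseteq G$ with index $(G:H)=p$ and some $\alpha\in G\setminus H$ with $G^{\bullet}\setminus\Sigma(T)\subseteq\alpha+H$. *)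

theory Defs
  imports "HOL-Algebra.Algebra" "HOL-Library.Multiset" "HOL-Computational_Algebra.Primes"
begin

text \<open>
  Groups follow the conventions of HOL-Algebra and are therefore written multiplicatively: the zero
  element is \<open>\<one>\<^bsub>G\<^esub>\<close>, a sum is a product, and the coset \<open>\<alpha> + H\<close> is \<open>H #>\<^bsub>G\<^esub> \<alpha>\<close>.
  A sequence over \<open>G\<close> is a finite multiset with elements in \<open>carrier G\<close>; its length is \<open>size\<close>
  and its subsequences are its submultisets.
\<close>

definition sequence_over :: "('a, 'b) monoid_scheme \<Rightarrow> 'a multiset \<Rightarrow> bool" where
  "sequence_over G T \<longleftrightarrow> set_mset T \<subseteq> carrier G"

definition seq_sum :: "('a, 'b) monoid_scheme \<Rightarrow> 'a multiset \<Rightarrow> 'a" where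
  "seq_sum G T = (\<Otimes>\<^bsub>G\<^esub>g\<in>set_mset T. g [^]\<^bsub>G\<^esub> count T g)"

lemma (in comm_monoid) seq_sum_empty [simp]: "seq_sum G {#} = \<one>"
  by (simp add: seq_sum_def)

lemma (in comm_group) seq_sum_add_mset:
  assumes x: "x \<in> carrier G" and T: "sequence_over G T"
  shows "seq_sum G (add_mset x T) = x \<otimes> seq_sum G T"
proof -
  let ?A = "set_mset T - {x}"
  have A: "?A \<subseteq> carrier G" and TG: "set_mset T \<subseteq> carrier G"
    using T by (auto simp: sequence_over_def)
  have split: "seq_sum G U = x [^] count U x \<otimes> (\<Otimes>g\<in>?A. g [^] count T g)"
    if U: "insert x (set_mset U) = insert x (set_mset T)"
      "\<And>g. g \<noteq> x \<Longrightarrow> count U g = count T g" for U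
  proof -
    have "seq_sum G U = (\<Otimes>g\<in>insert x (set_mset U). g [^] count U g)"
      unfolding seq_sum_def using U TG x
      by (intro finprod_mono_neutral_cong_left) (auto simp: not_in_iff)
    also have "insert x (set_mset U) = insert x ?A"
      using U(1) by auto
    also have "(\<Otimes>g\<in>insert x ?A. g [^] count U g)
        = x [^] count U x \<otimes> (\<Otimes>g\<in>?A. g [^] count U g)"
      using A x by (intro finprod_insert) auto
    also have "(\<Otimes>g\<in>?A. g [^] count U g) = (\<Otimes>g\<in>?A. g [^] count T g)"
      using A U(2) by (intro finprod_cong') auto
    finally show ?thesis .
  qed
  have P: "(\<Otimes>g\<in>?A. g [^] count T g) \<in> carrier G"
    using A by (intro finprod_closed) auto
  show ?thesis
    using split[of T] split[of "add_mset x T"] x P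
    by (simp add: m_assoc m_lcomm)
qed

definition subsums :: "('a, 'b) monoid_scheme \<Rightarrow> 'a multiset \<Rightarrow> 'a set" where
  "subsums G T = {seq_sum G S |S. S \<subseteq># T \<and> S \<noteq> {#}}"

definition zero_sum_free :: "('a, 'b) monoid_scheme \<Rightarrow> 'a multiset \<Rightarrow> bool" where
  "zero_sum_free G T \<longleftrightarrow> sequence_over G T \<and> \<one>\<^bsub>G\<^esub> \<notin> subsums G T"

definition small_davenport :: "('a, 'b) monoid_scheme \<Rightarrow> nat" where
  "small_davenport G = Max {size T |T. zero_sum_free G T}"

definition nu :: "('a, 'b) monoid_scheme \<Rightarrow> nat" where
  "nu G = (LEAST l. \<forall>T. zero_sum_free G T \<and> size T \<ge> l \<longrightarrow>
     (\<exists>H \<alpha>. subgroup H G \<and> H \<subset> carrier G \<and> \<alpha> \<in> carrier G - H \<and>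
        (carrier G - {\<one>\<^bsub>G\<^esub>}) - subsums G T \<subseteq> H #>\<^bsub>G\<^esub> \<alpha>))"

text \<open>The index \<open>(G:H)\<close> is the number of cosets of \<open>H\<close>.\<close>

definition nu_prime :: "nat \<Rightarrow> ('a, 'b) monoid_scheme \<Rightarrow> nat" where
  "nu_prime p G = (LEAST l. \<forall>T. zero_sum_free G T \<and> size T \<ge> l \<longrightarrow>
     (\<exists>H \<alpha>. subgroup H G \<and> card (rcosets\<^bsub>G\<^esub> H) = p \<and> \<alpha> \<in> carrier G - H \<and>
        (carrier G - {\<one>\<^bsub>G\<^esub>}) - subsums G T \<subseteq> H #>\<^bsub>G\<^esub> \<alpha>))"

end

(*
  Appending x to a zero-sum free sequence T adds at least one new subsequence sum, namely
  sigma(T) + x, so |Sigma(T)| >= |T| and d(G) = n - 1 for G cyclic of order n. Two distinct terms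
  would add three new sums to those of the remaining sequence, so a zero-sum free sequence of
  length n - 1 is constant; its sums exhaust the nonzero elements of G, so its term generates G.
  If |T| >= n - 2 and b is a nonzero element outside Sigma(T), then T together with -b is again
  zero-sum free, of length n - 1. Hence -b generates G, no proper subgroup contains b, and b is the
  only missing element. Conversely, for a generator g the sequence g^(n-3) misses -2g and -g, and
  a coset containing both belongs to a subgroup containing g.
*)

theory Submission
  imports Defs
begin

context comm_group
begin

section \<open>Sequence sums and sets of subsequence sums\<close>

lemma seq_sum_closed_subgroup:
  assumes "subgroup H G" "set_mset T \<subseteq> H"
  shows "seq_sum G T \<in> H"
  using assms(2)
proof (induction T)
  case empty
  then show ?case using assms(1) by (simp add: subgroup.one_closed)
next
  case (add x T)
  then show ?case
    using assms(1) subgroup.subset[OF assms(1)]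
    by (subst seq_sum_add_mset) (auto simp: sequence_over_def subgroup.m_closed)
qed

lemma seq_sum_closed: "sequence_over G T \<Longrightarrow> seq_sum G T \<in> carrier G"
  using seq_sum_closed_subgroup[OF subgroup_self] by (simp add: sequence_over_def)

lemma seq_sum_union:
  assumes "sequence_over G S" "sequence_over G T"
  shows "seq_sum G (S + T) = seq_sum G S \<otimes> seq_sum G T"
  using assms(1)
proof (induction S)
  case empty
  then show ?case using assms(2) by (simp add: seq_sum_closed)
next
  case (add x S)
  then have "x \<in> carrier G" "sequence_over G S" "sequence_over G (S + T)"
    using assms(2) by (auto simp: sequence_over_def)
  then show ?case
    using add.IH assms(2) by (simp add: seq_sum_add_mset seq_sum_closed m_assoc)
qed

lemma seq_sum_replicate_mset:
  "g \<in> carrier G \<Longrightarrow> seq_sum G (replicate_mset k g) = g [^] k"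
proof (induction k)
  case (Suc k)
  then show ?case
    by (simp only: replicate_mset_Suc, subst seq_sum_add_mset)
      (auto simp: sequence_over_def m_comm)
qed simp

lemma sequence_over_mono: "sequence_over G T \<Longrightarrow> S \<subseteq># T \<Longrightarrow> sequence_over G S"
  by (auto simp: sequence_over_def dest: mset_subset_eqD)

lemma sequence_over_add_mset [simp]:
  "sequence_over G (add_mset x T) \<longleftrightarrow> x \<in> carrier G \<and> sequence_over G T"
  by (auto simp: sequence_over_def)

lemma subsums_closed_subgroup:
  assumes "subgroup H G" "set_mset T \<subseteq> H"
  shows "subsums G T \<subseteq> H"
proof
  fix s assume "s \<in> subsums G T"
  then obtain S where "s = seq_sum G S" "S \<subseteq># T"
    by (auto simp: subsums_def)
  moreover from this have "set_mset S \<subseteq> H"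
    using assms(2) set_mset_mono by blast
  ultimately show "s \<in> H"
    using seq_sum_closed_subgroup[OF assms(1)] by simp
qed

lemma subsums_closed: "sequence_over G T \<Longrightarrow> subsums G T \<subseteq> carrier G"
  using subsums_closed_subgroup[OF subgroup_self] by (simp add: sequence_over_def)

lemma subsums_mono: "S \<subseteq># T \<Longrightarrow> subsums G S \<subseteq> subsums G T"
  by (auto simp: subsums_def intro: subset_mset.order_trans)

lemma seq_sum_in_subsums: "S \<subseteq># T \<Longrightarrow> S \<noteq> {#} \<Longrightarrow> seq_sum G S \<in> subsums G T"
  by (auto simp: subsums_def)

text \<open>Submultisets of a constant multiset are constant, so only their length matters; exponent
  0 is left out because subsequences in \<open>subsums\<close> are nonempty.\<close>

lemma subsums_replicate_mset:
  assumes "g \<in> carrier G"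
  shows "subsums G (replicate_mset m g) = (\<lambda>k. g [^] k) ` {1..m}"
proof (intro equalityI subsetI)
  fix s assume "s \<in> subsums G (replicate_mset m g)"
  then obtain S where S: "s = seq_sum G S" "S \<subseteq># replicate_mset m g" "S \<noteq> {#}"
    by (auto simp: subsums_def)
  then obtain k where "k \<le> m" "S = replicate_mset k g"
    by (auto elim: msubseteq_replicate_msetE)
  then show "s \<in> (\<lambda>k. g [^] k) ` {1..m}"
    using S assms by (auto simp: seq_sum_replicate_mset Suc_le_eq intro!: imageI gr0I)
next
  fix s assume "s \<in> (\<lambda>k. g [^] k) ` {1..m}"
  then obtain k where k: "1 \<le> k" "k \<le> m" "s = g [^] k" by auto
  have "seq_sum G (replicate_mset k g) \<in> subsums G (replicate_mset m g)"
    using k by (intro seq_sum_in_subsums) (auto simp: subseteq_mset_def)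
  then show "s \<in> subsums G (replicate_mset m g)"
    using k assms by (simp add: seq_sum_replicate_mset)
qed

section \<open>Zero-sum free sequences and their extension\<close>

lemma zero_sum_free_mono: "zero_sum_free G T \<Longrightarrow> S \<subseteq># T \<Longrightarrow> zero_sum_free G S"
  using subsums_mono sequence_over_mono unfolding zero_sum_free_def by blast

lemma zero_sum_free_subsums: "zero_sum_free G T \<Longrightarrow> subsums G T \<subseteq> carrier G - {\<one>}"
  using subsums_closed by (auto simp: zero_sum_free_def)

text \<open>If the total of \<open>T + R\<close> were the sum of some \<open>S\<close> inside
  \<open>T\<close>, the complement of \<open>S\<close> in \<open>T + R\<close> would sum to the
  identity, and it is nonempty because it contains \<open>R\<close>.\<close>

lemma seq_sum_union_notin_subsums:
  assumes zsf: "zero_sum_free G (T + R)" and "R \<noteq> {#}"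
  shows "seq_sum G (T + R) \<notin> subsums G T"
proof
  assume "seq_sum G (T + R) \<in> subsums G T"
  then obtain S where S: "S \<subseteq># T" "seq_sum G (T + R) = seq_sum G S"
    by (auto simp: subsums_def)
  then obtain U where U: "T = S + U"
    using subset_mset.le_iff_add by blast
  have seq: "sequence_over G S" "sequence_over G (U + R)"
    using zsf unfolding U by (auto simp: zero_sum_free_def sequence_over_def)
  have "seq_sum G S \<otimes> seq_sum G (U + R) = seq_sum G S"
    using S(2) seq_sum_union[OF seq] unfolding U by (simp add: add.assoc)
  then have "seq_sum G (U + R) = \<one>"
    using seq by (simp add: seq_sum_closed r_cancel_one)
  moreover have "seq_sum G (U + R) \<in> subsums G (T + R)"
    using \<open>R \<noteq> {#}\<close> unfolding U by (intro seq_sum_in_subsums) auto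
  ultimately show False
    using zsf by (simp add: zero_sum_free_def)
qed

text \<open>A subsequence summing to the identity would have to use the new term; removing that term
  leaves a subsequence of \<open>T\<close> with sum \<open>b\<close>, nonempty since
  \<open>b\<close> is not the identity.\<close>

lemma zero_sum_free_add_inv:
  assumes T: "zero_sum_free G T" and b: "b \<in> carrier G - {\<one>}" "b \<notin> subsums G T"
  shows "zero_sum_free G (add_mset (inv b) T)"
proof -
  have seq: "sequence_over G T"
    using T by (simp add: zero_sum_free_def)
  have "seq_sum G S \<noteq> \<one>" if S: "S \<subseteq># add_mset (inv b) T" "S \<noteq> {#}" for S
  proof
    assume one: "seq_sum G S = \<one>"
    show False
    proof (cases "S \<subseteq># T")
      case True
      then show False
        using T one S(2) seq_sum_in_subsums[of S T] by (simp add: zero_sum_free_def)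
    next
      case False
      \<comment> \<open>\<open>S\<close> exceeds \<open>T\<close> in some multiplicity, which can
        only be that of \<open>inv b\<close>. The split is on containment, not on membership,
        because \<open>inv b\<close> may already occur in \<open>T\<close>.\<close>
      then have "inv b \<in># S"
        using S(1) by (metis add_mset_remove_trivial diff_single_trivial
            subset_eq_diff_conv subset_mset.diff_add union_mset_add_mset_right add.right_neutral)
      then obtain U where U: "S = add_mset (inv b) U"
        by (meson multi_member_split)
      then have sub: "U \<subseteq># T"
        using S(1) by (simp add: mset_subset_eq_add_mset_cancel)
      have seqU: "sequence_over G U"
        using sequence_over_mono[OF seq sub] .
      have "inv b \<otimes> seq_sum G U = \<one>"
        using one b(1) seqU unfolding U by (simp add: seq_sum_add_mset)
      then have "seq_sum G U = b"
        using b(1) seqU seq_sum_closed by (metis DiffD1 inv_closed inv_equality inv_inv m_comm)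
      moreover have "U \<noteq> {#}"
        using calculation b(1) by auto
      ultimately show False
        using b(2) sub seq_sum_in_subsums by blast
    qed
  qed
  then have "\<one> \<notin> subsums G (add_mset (inv b) T)"
    unfolding subsums_def by force
  then show ?thesis
    using seq b(1) by (simp add: zero_sum_free_def)
qed

end

section \<open>Counting subsequence sums in a finite group\<close>

locale finite_comm_group = comm_group G for G (structure) +
  assumes finite_carrier [simp]: "finite (carrier G)"
begin

lemma finite_subsums: "sequence_over G T \<Longrightarrow> finite (subsums G T)"
  using subsums_closed finite_subset finite_carrier by blast

lemma size_le_card_subsums:
  "zero_sum_free G T \<Longrightarrow> size T \<le> card (subsums G T)"
proof (induction T)
  case (add x T)
  have fin: "finite (subsums G (add_mset x T))"
    using add.prems by (intro finite_subsums) (simp add: zero_sum_free_def)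
  have "size T \<le> card (subsums G T)"
    using add.IH zero_sum_free_mono[OF add.prems] by simp
  also have "\<dots> < card (subsums G (add_mset x T))"
  proof (rule psubset_card_mono[OF fin])
    have "seq_sum G (T + {#x#}) \<notin> subsums G T"
      using add.prems by (intro seq_sum_union_notin_subsums) simp_all
    moreover have "seq_sum G (T + {#x#}) \<in> subsums G (add_mset x T)"
      by (intro seq_sum_in_subsums) auto
    ultimately show "subsums G T \<subset> subsums G (add_mset x T)"
      using subsums_mono[of T "add_mset x T"] by auto
  qed
  finally show ?case by simp
qed simp

lemma card_subsums_le:
  assumes "zero_sum_free G T"
  shows "card (subsums G T) \<le> order G - 1"
  using card_mono[OF _ zero_sum_free_subsums[OF assms]] by (simp add: order_def)

text \<open>Removing \<open>x\<close> and \<open>y\<close> from \<open>T\<close> leaves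
  \<open>U\<close>. The totals of \<open>U\<close> with \<open>x\<close>, with \<open>y\<close> and
  with both are three distinct sums outside \<open>subsums G U\<close>, gained from only two
  terms.\<close>

lemma size_less_card_subsums:
  assumes zsf: "zero_sum_free G T" and xy: "x \<in># T" "y \<in># T" "x \<noteq> y"
  shows "size T + 1 \<le> card (subsums G T)"
proof -
  obtain U where U: "T = U + {#x, y#}"
    using xy by (metis add_mset_add_single insert_noteq_member multi_member_split union_mset_add_mset_right)
  let ?a = "seq_sum G (U + {#x#})" and ?b = "seq_sum G (U + {#y#})"
    and ?c = "seq_sum G (U + {#x, y#})"
  have zsf': "zero_sum_free G (U + {#x#})" "zero_sum_free G (U + {#y#})"
    by (rule zero_sum_free_mono[OF zsf], simp add: U)+
  have notin: "?a \<notin> subsums G U" "?b \<notin> subsums G U" "?c \<notin> subsums G U"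
    using zsf zsf' unfolding U by (intro seq_sum_union_notin_subsums; simp)+
  \<comment> \<open>\<open>?c\<close> is the total after one more term is appended to either
    intermediate sequence, so it differs from \<open>?a\<close> and \<open>?b\<close>, which are
    sums over those sequences.\<close>
  have "?c \<notin> subsums G (U + {#x#})" "?c \<notin> subsums G (U + {#y#})"
    using seq_sum_union_notin_subsums[of "U + {#x#}" "{#y#}"]
      seq_sum_union_notin_subsums[of "U + {#y#}" "{#x#}"] zsf
    unfolding U by (simp_all add: add_mset_commute)
  then have ne: "?a \<noteq> ?c" "?b \<noteq> ?c"
    using seq_sum_in_subsums[of "U + {#x#}" "U + {#x#}"]
      seq_sum_in_subsums[of "U + {#y#}" "U + {#y#}"] by auto
  have "sequence_over G U" "x \<in> carrier G" "y \<in> carrier G"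
    using zsf unfolding U by (auto simp: zero_sum_free_def)
  then have "?a \<noteq> ?b"
    using xy(3) by (simp add: seq_sum_add_mset seq_sum_closed)
  have "size U + 3 \<le> card (subsums G U) + 3"
    using size_le_card_subsums zero_sum_free_mono[OF zsf, of U] by (simp add: U)
  also have "\<dots> = card (insert ?a (insert ?b (insert ?c (subsums G U))))"
    using notin ne \<open>?a \<noteq> ?b\<close> finite_subsums[OF \<open>sequence_over G U\<close>] by simp
  also have "\<dots> \<le> card (subsums G T)"
  proof (rule card_mono)
    show "finite (subsums G T)"
      using zsf by (intro finite_subsums) (simp add: zero_sum_free_def)
    show "insert ?a (insert ?b (insert ?c (subsums G U))) \<subseteq> subsums G T"
      using subsums_mono[of U T] unfolding U
      by (auto intro!: seq_sum_in_subsums simp del: union_mset_add_mset_right)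
  qed
  finally show ?thesis by (simp add: U)
qed

section \<open>Zero-sum free sequences of maximal and next-to-maximal length\<close>

lemma zero_sum_free_size: "zero_sum_free G T \<Longrightarrow> size T \<le> order G - 1"
  using size_le_card_subsums card_subsums_le le_trans by blast

text \<open>Two distinct terms would force at least \<open>order G\<close> different sums, but the
  identity is not among the sums.\<close>

lemma zero_sum_free_maximal_constant:
  assumes "zero_sum_free G T" "order G - 1 \<le> size T" "x \<in># T" "y \<in># T"
  shows "x = y"
  using size_less_card_subsums[of T x y] card_subsums_le[of T] assms by fastforce

lemma zero_sum_free_maximal_subsums:
  assumes "zero_sum_free G T" "order G - 1 \<le> size T"
  shows "subsums G T = carrier G - {\<one>}"
proof (rule card_subset_eq)
  show "card (subsums G T) = card (carrier G - {\<one>})"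
    using size_le_card_subsums[OF assms(1)] card_subsums_le[OF assms(1)] assms(2)
    by (simp add: order_def)
qed (use zero_sum_free_subsums[OF assms(1)] in auto)

lemma missing_element_generates:
  assumes T: "zero_sum_free G T" "order G - 2 \<le> size T"
    and b: "b \<in> carrier G - {\<one>}" "b \<notin> subsums G T"
    and H: "subgroup H G" "b \<in> H"
  shows "H = carrier G"
proof -
  let ?T = "add_mset (inv b) T"
  have zsf: "zero_sum_free G ?T"
    using zero_sum_free_add_inv[OF T(1) b] .
  have size: "order G - 1 \<le> size ?T"
    using T(2) by simp
  have "set_mset ?T \<subseteq> {inv b}"
    using zero_sum_free_maximal_constant[OF zsf size, of _ "inv b"] by auto
  then have "set_mset ?T \<subseteq> H"
    using H by (auto simp: subgroup.m_inv_closed)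
  then have "carrier G - {\<one>} \<subseteq> H"
    \<comment> \<open>The sums of \<open>?T\<close> exhaust the nonidentity elements, yet they stay
      in \<open>H\<close> because all terms do.\<close>
    using zero_sum_free_maximal_subsums[OF zsf size] subsums_closed_subgroup[OF H(1)] by metis
  then show ?thesis
    using H(1) subgroup.subset subgroup.one_closed by blast
qed

text \<open>At most one element \<open>b\<close> is missing, and it lies outside every proper
  subgroup, so \<open>b\<close> itself can represent the coset. Since \<open>H\<close> is an
  arbitrary proper subgroup, the index can be prescribed later.\<close>

lemma missing_subset_coset:
  assumes T: "zero_sum_free G T" "order G - 2 \<le> size T"
    and H: "subgroup H G" "H \<noteq> carrier G"
  shows "\<exists>\<alpha>\<in>carrier G - H. carrier G - {\<one>} - subsums G T \<subseteq> H #> \<alpha>"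
proof (cases "carrier G - {\<one>} - subsums G T = {}")
  case True
  \<comment> \<open>With nothing missing, any element outside \<open>H\<close> serves as
    \<open>\<alpha>\<close>.\<close>
  then show ?thesis
    using H subgroup.subset by fastforce
next
  case False
  then obtain b where b: "b \<in> carrier G - {\<one>} - subsums G T" by auto
  have "card (carrier G - {\<one>} - subsums G T) = order G - 1 - card (subsums G T)"
    using T(1) zero_sum_free_subsums[OF T(1)]
    by (subst card_Diff_subset) (auto simp: order_def zero_sum_free_def finite_subsums)
  \<comment> \<open>At least \<open>order G - 2\<close> of the \<open>order G - 1\<close>
    nonidentity elements are sums.\<close>
  also have "\<dots> \<le> 1"
    using size_le_card_subsums[OF T(1)] T(2) by simp
  finally have "carrier G - {\<one>} - subsums G T = {b}"
    using b by (metis card_le_Suc0_iff_eq One_nat_def finite_carrier finite_Diff is_singletonI'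
        is_singleton_the_elem empty_iff singletonD)
  moreover have "b \<notin> H"
    using missing_element_generates[OF T, of b H] b H by auto
  moreover have "b \<in> H #> b"
    using b H(1) rcos_self by auto
  ultimately show ?thesis
    using b by auto
qed

section \<open>Constant sequences over a generator, and subgroups of a cyclic group\<close>

lemma zero_sum_free_replicate_mset:
  assumes "g \<in> carrier G" "m < ord g"
  shows "zero_sum_free G (replicate_mset m g)"
  using assms
  \<comment> \<open>A sum equal to the identity is a power with exponent \<open>k\<close> in
    \<open>{1..m}\<close> divisible by \<open>ord g\<close>, which contradicts
    \<open>m < ord g\<close>.\<close>
  by (auto simp: zero_sum_free_def subsums_replicate_mset sequence_over_def pow_eq_id
      dest!: sym[of \<one>] dvd_imp_le)

lemma small_davenport_cyclic:
  assumes "g \<in> carrier G" "ord g = order G"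
  shows "small_davenport G = order G - 1"
  unfolding small_davenport_def
proof (rule Max_eqI)
  \<comment> \<open>Besides bounding the maximum, this gives the finiteness that \<open>Max\<close>
    requires.\<close>
  have bound: "\<forall>k\<in>{size T |T. zero_sum_free G T}. k \<le> order G - 1"
    using zero_sum_free_size by auto
  then show "finite {size T |T. zero_sum_free G T}"
    using finite_nat_set_iff_bounded_le by blast
  show "k \<le> order G - 1" if "k \<in> {size T |T. zero_sum_free G T}" for k
    using bound that by blast
  have "order G - 1 < ord g"
    using assms order_gt_0_iff_finite by simp
  then show "order G - 1 \<in> {size T |T. zero_sum_free G T}"
    using zero_sum_free_replicate_mset[OF assms(1), of "order G - 1"]
    by (auto intro!: exI[of _ "replicate_mset (order G - 1) g"])
qed

lemma subgroup_containing_generator: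
  assumes "g \<in> carrier G" "ord g = order G" "subgroup H G" "g \<in> H"
  shows "H = carrier G"
proof (rule card_subset_eq)
  have "generate G {g} \<subseteq> H"
    using assms(3,4) by (simp add: generate_subgroup_incl)
  then have "order G \<le> card H"
    using card_mono[of H "generate G {g}"] assms finite_subset[OF subgroup.subset[OF assms(3)]]
    by (simp add: generate_pow_card[OF assms(1), symmetric])
  moreover have "card H \<le> order G"
    using subgroup.subset[OF assms(3)] by (simp add: order_def card_mono)
  ultimately show "card H = card (carrier G)"
    by (simp add: order_def)
qed (use subgroup.subset[OF assms(3)] in auto)

text \<open>Two consecutive powers of \<open>g\<close> are missing. If both lay in one coset of
  \<open>H\<close>, their quotient \<open>g\<close> would lie in \<open>H\<close>, making
  \<open>H\<close> the whole group.\<close>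

lemma replicate_mset_missing_not_in_coset:
  assumes g: "g \<in> carrier G" "ord g = order G" and m: "m + 3 \<le> order G"
    and H: "subgroup H G" "H \<noteq> carrier G" and \<alpha>: "\<alpha> \<in> carrier G"
  shows "\<not> carrier G - {\<one>} - subsums G (replicate_mset m g) \<subseteq> H #> \<alpha>"
proof
  assume sub: "carrier G - {\<one>} - subsums G (replicate_mset m g) \<subseteq> H #> \<alpha>"
  have "g [^] k \<in> H #> \<alpha>" if k: "m < k" "k < order G" for k
  proof -
    have inj: "inj_on (\<lambda>k. g [^] k) {0..ord g - 1}"
      using ord_inj[OF g(1)] .
    \<comment> \<open>Including \<open>j = 0\<close> also separates \<open>g [^] k\<close> from the
      identity.\<close>
    have ne: "g [^] k \<noteq> g [^] j" if "j \<le> m" for j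
      using inj_onD[OF inj, of k j] k g(2) that by fastforce
    have "g [^] k \<notin> subsums G (replicate_mset m g)"
      unfolding subsums_replicate_mset[OF g(1)] using ne by (metis atLeastAtMost_iff imageE)
    moreover have "g [^] k \<noteq> \<one>"
      using ne[of 0] by simp
    ultimately show ?thesis
      using sub g(1) by blast
  qed
  \<comment> \<open>Both exponents are below \<open>order G\<close> exactly because
    \<open>m + 3 \<le> order G\<close>.\<close>
  from this[of "m + 1"] this[of "Suc (m + 1)"] m
  have "g [^] (m + 1) \<in> H #> \<alpha>" "g [^] Suc (m + 1) \<in> H #> \<alpha>"
    by auto
  then obtain h h' where h: "h \<in> H" "g [^] (m + 1) = h \<otimes> \<alpha>"
      and h': "h' \<in> H" "g [^] Suc (m + 1) = h' \<otimes> \<alpha>"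
    by (auto simp: r_coset_def)
  have carr: "h \<in> carrier G" "h' \<in> carrier G"
    using h(1) h'(1) subgroup.subset[OF H(1)] by auto
  have "(h \<otimes> g) \<otimes> \<alpha> = (h \<otimes> \<alpha>) \<otimes> g"
    using carr g(1) \<alpha> by (simp add: m_ac)
  also have "\<dots> = h' \<otimes> \<alpha>"
    using h(2) h'(2) by simp
  finally have "h \<otimes> g = h'"
    using carr g(1) \<alpha> by simp
  then have "g = inv h \<otimes> h'"
    using carr g(1) inv_solve_left by metis
  then have "g \<in> H"
    using h(1) h'(1) H(1) by (simp add: subgroup.m_closed subgroup.m_inv_closed)
  then show False
    using subgroup_containing_generator[OF g H(1)] H(2) by simp
qed

text \<open>The power \<open>g [^] p\<close> generates a subgroup of order
  \<open>order G div p\<close>; Lagrange's theorem then gives its index.\<close>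

lemma exists_subgroup_of_index:
  assumes g: "g \<in> carrier G" "ord g = order G" and p: "p dvd order G"
  shows "\<exists>H. subgroup H G \<and> card (rcosets H) = p"
proof (intro exI conjI)
  let ?H = "generate G {g [^] p}"
  have pos: "0 < order G"
    using order_gt_0_iff_finite by simp
  then have "0 < p"
    using p by (auto intro: Nat.gr0I)
  show sub: "subgroup ?H G"
    using g(1) by (intro generate_is_subgroup) simp
  have "card ?H = order G div p"
    using ord_pow[OF g(1), of p] generate_pow_card[of "g [^] p"] g p \<open>0 < p\<close> by simp
  then have "card (rcosets ?H) * (order G div p) = p * (order G div p)"
    using lagrange[OF sub] p by simp
  moreover have "order G div p \<noteq> 0"
    using p pos by (auto simp: dvd_div_eq_0_iff)
  ultimately show "card (rcosets ?H) = p" by simp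
qed

end

section \<open>Both invariants of a cyclic group, compared with the Davenport constant\<close>

theorem proposition3p3:
  fixes G :: "('a, 'b) monoid_scheme" and n p :: nat
  assumes "group G" and "cyclic_group G" and "finite (carrier G)"
    and "order G = n" and "n \<ge> 2"
    and "Factorial_Ring.prime p" and "p dvd order G"
  shows "nu G = nu_prime p G \<and> int (nu_prime p G) = int (small_davenport G) - 1"
proof -
  interpret group G by fact
  interpret finite_comm_group G
    using cyclic_imp_abelian_group[OF assms(2)] assms(3)
    by (simp add: finite_comm_group_def finite_comm_group_axioms_def)
  obtain g where g: "g \<in> carrier G" "subgroup_generated G {g} = G"
    using assms(2) by (auto simp: cyclic_group_def)
  then have "generate G {g} = carrier G"
    by (metis carrier_subgroup_generated Int_insert_right_if1 inf_bot_right)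
  then have ord: "ord g = order G"
    using generate_pow_card[OF g(1)] by (simp add: order_def)
  obtain H where H: "subgroup H G" "card (rcosets\<^bsub>G\<^esub> H) = p"
    using exists_subgroup_of_index[OF g(1) ord assms(7)] by blast
  \<comment> \<open>The whole group has index 1, whereas \<open>p > 1\<close>.\<close>
  have proper: "K \<noteq> carrier G" if "subgroup K G" "card (rcosets\<^bsub>G\<^esub> K) = p" for K
  proof
    assume "K = carrier G"
    then have "p * order G = 1 * order G"
      using lagrange[OF that(1)] that(2) by (simp add: order_def)
    then show False
      using assms(4-6) prime_gt_1_nat[of p] by simp
  qed
  \<comment> \<open>The fixed subgroup \<open>H\<close> of index \<open>p\<close> works for every
    long \<open>T\<close>, so it witnesses the conditions of \<open>nu\<close> and
    \<open>nu_prime\<close> alike.\<close>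
  have upper: "\<exists>\<alpha>. \<alpha> \<in> carrier G - H \<and> carrier G - {\<one>\<^bsub>G\<^esub>} - subsums G T \<subseteq> H #>\<^bsub>G\<^esub> \<alpha>"
    if "zero_sum_free G T" "n - 2 \<le> size T" for T
    using missing_subset_coset[OF that(1) _ H(1) proper[OF H]] that(2) assms(4) by blast
  \<comment> \<open>The witness is \<open>g\<close> repeated \<open>l\<close> times, where
    \<open>l < n - 2\<close> means \<open>l + 3 \<le> n\<close>. It defeats every coset of every
    proper subgroup, hence both conditions at once; for \<open>n = 2\<close> there is no such
    \<open>l\<close>.\<close>
  have lower: "\<exists>T. zero_sum_free G T \<and> l \<le> size T \<and>
      (\<forall>K \<alpha>. subgroup K G \<longrightarrow> K \<noteq> carrier G \<longrightarrow> \<alpha> \<in> carrier G \<longrightarrow>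
        \<not> carrier G - {\<one>\<^bsub>G\<^esub>} - subsums G T \<subseteq> K #>\<^bsub>G\<^esub> \<alpha>)" if "l < n - 2" for l
    using that assms(4) ord zero_sum_free_replicate_mset[OF g(1), of "l"]
      replicate_mset_missing_not_in_coset[OF g(1) ord, of l]
    by (intro exI[of _ "replicate_mset l g"]) auto
  have "nu G = n - 2"
    unfolding nu_def
  proof (rule Least_equality)
    have "H \<subset> carrier G"
      using proper[OF H] subgroup.subset[OF H(1)] by blast
    then show "\<forall>T. zero_sum_free G T \<and> n - 2 \<le> size T \<longrightarrow>
        (\<exists>H \<alpha>. subgroup H G \<and> H \<subset> carrier G \<and> \<alpha> \<in> carrier G - H \<and>
          carrier G - {\<one>\<^bsub>G\<^esub>} - subsums G T \<subseteq> H #>\<^bsub>G\<^esub> \<alpha>)"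
      using upper H(1) by blast
  next
    fix l
    assume l: "\<forall>T. zero_sum_free G T \<and> l \<le> size T \<longrightarrow>
        (\<exists>H \<alpha>. subgroup H G \<and> H \<subset> carrier G \<and> \<alpha> \<in> carrier G - H \<and>
          carrier G - {\<one>\<^bsub>G\<^esub>} - subsums G T \<subseteq> H #>\<^bsub>G\<^esub> \<alpha>)"
    show "n - 2 \<le> l"
    proof (rule ccontr)
      assume "\<not> n - 2 \<le> l"
      then show False
        using lower[of l] l by (metis DiffD1 not_le psubsetE order_refl)
    qed
  qed
  moreover have "nu_prime p G = n - 2"
    unfolding nu_prime_def
  proof (rule Least_equality)
    show "\<forall>T. zero_sum_free G T \<and> n - 2 \<le> size T \<longrightarrow>
        (\<exists>H \<alpha>. subgroup H G \<and> card (rcosets\<^bsub>G\<^esub> H) = p \<and> \<alpha> \<in> carrier G - H \<and>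
          carrier G - {\<one>\<^bsub>G\<^esub>} - subsums G T \<subseteq> H #>\<^bsub>G\<^esub> \<alpha>)"
      using upper H by blast
  next
    fix l
    assume l: "\<forall>T. zero_sum_free G T \<and> l \<le> size T \<longrightarrow>
        (\<exists>H \<alpha>. subgroup H G \<and> card (rcosets\<^bsub>G\<^esub> H) = p \<and> \<alpha> \<in> carrier G - H \<and>
          carrier G - {\<one>\<^bsub>G\<^esub>} - subsums G T \<subseteq> H #>\<^bsub>G\<^esub> \<alpha>)"
    show "n - 2 \<le> l"
    proof (rule ccontr)
      assume "\<not> n - 2 \<le> l"
      then show False
        using lower[of l] l proper by (metis DiffD1 not_le)
    qed
  qed
  \<comment> \<open>The Davenport constant is \<open>n - 1\<close>; as \<open>n \<ge> 2\<close>, the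
    natural subtraction in \<open>n - 2\<close> does not truncate and agrees with the integer
    one.\<close>
  ultimately show ?thesis
    using small_davenport_cyclic[OF g(1) ord] assms(4,5) by simp
qed

end
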